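(* There exists a universal constant $C>0$ such that for every $0<a<1$, every real $u>1$ and every integer $n\ge 1$, $$\psi_{\mu_a}(u)\le C\,\kappa_a^2\left(\frac{\log\kappa_a}{\kappa_a-1}\right)^{1/2}\frac{1}{\sqrt{\log u}},\qquad\text{where }\kappa_a=\frac{1+a}{1-a}.$$
   Context: Let $G=\{-1,1\}^n$ with uniform probability measure $\lambda$, and let $x\odot y$ denote coordinatewise multiplication. For a finite positive measure $\mu$ on $G$ and $f:G\to\mathbb R$, put $T_\mu f(x)=\int_G f(x\odot y)\,d\mu(y)$ and, for $u>0$, $$\psi_\mu(u)=\sup\{u\,\lambda(\{T_\mu f\ge u\}): f:G\to[0,\infty),\ \|f\|_1=1\},$$ where $\|f\|_1=\int_G|f|\,d\lambda$. For $0<a<1$, $\mu_a=\left(\frac{1+a}{2}\delta_1+\frac{1-a}{2}\delta_{-1}\right)^{\otimes n}$ is a product probability measure on $G$. "Universal constant" means a constant independent of $a$, $u$ and $n$. *)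

theory Defs
  imports "HOL-Probability.Probability"
begin

text \<open>
  The dimension \<open>n\<close> has to be quantified inside the statement (the constant must not depend on
  it), so the group \<open>{-1, 1}\<^sup>n\<close> is a carrier set of functions on \<open>{..<n}\<close> and not a type.
  As usual for \<open>PiE\<close>, these functions are \<open>undefined\<close> outside \<open>{..<n}\<close>.
\<close>

definition cube :: "nat \<Rightarrow> (nat \<Rightarrow> real) set" where
  "cube n = {..<n} \<rightarrow>\<^sub>E {-1, 1}"

definition cube_mult :: "nat \<Rightarrow> (nat \<Rightarrow> real) \<Rightarrow> (nat \<Rightarrow> real) \<Rightarrow> (nat \<Rightarrow> real)" where
  "cube_mult n x y = (\<lambda>i\<in>{..<n}. x i * y i)"

definition cube_unif :: "nat \<Rightarrow> (nat \<Rightarrow> real) measure" where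
  "cube_unif n = uniform_count_measure (cube n)"

definition L1_norm :: "nat \<Rightarrow> ((nat \<Rightarrow> real) \<Rightarrow> real) \<Rightarrow> real" where
  "L1_norm n f = (\<integral>x. \<bar>f x\<bar> \<partial>cube_unif n)"

definition conv_op ::
  "nat \<Rightarrow> (nat \<Rightarrow> real) measure \<Rightarrow> ((nat \<Rightarrow> real) \<Rightarrow> real) \<Rightarrow> (nat \<Rightarrow> real) \<Rightarrow> real" where
  "conv_op n \<mu> f x = (\<integral>y. f (cube_mult n x y) \<partial>\<mu>)"

text \<open>
  The real-valued \<open>Sup\<close> is a genuine supremum for \<open>u > 0\<close>: the set contains the value at the
  constant function 1 and is bounded by \<open>u\<close>; see \<open>psi_set_nonempty\<close> and \<open>psi_set_bdd\<close> below.
\<close>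

definition psi_set :: "nat \<Rightarrow> (nat \<Rightarrow> real) measure \<Rightarrow> real \<Rightarrow> real set" where
  "psi_set n \<mu> u =
     {u * measure (cube_unif n) {x \<in> cube n. conv_op n \<mu> f x \<ge> u} | f.
        f \<in> cube n \<rightarrow> {0..} \<and> L1_norm n f = 1}"

definition psi :: "nat \<Rightarrow> (nat \<Rightarrow> real) measure \<Rightarrow> real \<Rightarrow> real" where
  "psi n \<mu> u = Sup (psi_set n \<mu> u)"

definition sign_measure :: "real \<Rightarrow> real measure" where
  "sign_measure a =
     point_measure {-1, 1} (\<lambda>s. ennreal (if s = 1 then (1 + a) / 2 else (1 - a) / 2))"

definition mu :: "nat \<Rightarrow> real \<Rightarrow> (nat \<Rightarrow> real) measure" where
  "mu n a = (\<Pi>\<^sub>M i\<in>{..<n}. sign_measure a)"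

definition kappa :: "real \<Rightarrow> real" where
  "kappa a = (1 + a) / (1 - a)"

lemma finite_cube: "finite (cube n)"
  by (simp add: cube_def finite_PiE)

lemma cube_nonempty: "cube n \<noteq> {}"
  by (auto simp: cube_def PiE_eq_empty_iff)

lemma prob_space_cube_unif: "prob_space (cube_unif n)"
  unfolding cube_unif_def
  by (rule prob_space_uniform_count_measure[OF finite_cube cube_nonempty])

lemma psi_set_nonempty: "psi_set n \<mu> u \<noteq> {}"
proof -
  interpret prob_space "cube_unif n" by (rule prob_space_cube_unif)
  have "L1_norm n (\<lambda>_. 1) = 1"
    by (simp add: L1_norm_def prob_space)
  then show ?thesis
    unfolding psi_set_def by (auto intro!: exI[of _ "\<lambda>_. 1"])
qed

lemma psi_set_bdd: "u \<ge> 0 \<Longrightarrow> bdd_above (psi_set n \<mu> u)"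
proof -
  assume u: "u \<ge> 0"
  interpret prob_space "cube_unif n" by (rule prob_space_cube_unif)
  show ?thesis
    unfolding psi_set_def using u by (intro bdd_aboveI[of _ u]) (auto intro!: mult_left_le)
qed

lemma prob_space_sign_measure:
  assumes "0 < a" "a < 1"
  shows "prob_space (sign_measure a)"
proof
  have "emeasure (sign_measure a) {-1, 1} = ennreal ((1 - a) / 2) + ennreal ((1 + a) / 2)"
    unfolding sign_measure_def by (subst emeasure_point_measure_finite) auto
  also have "\<dots> = 1"
    using assms by (subst ennreal_plus[symmetric]) (auto simp: field_simps)
  finally show "emeasure (sign_measure a) (space (sign_measure a)) = 1"
    by (simp add: sign_measure_def space_point_measure)
qed

lemma prob_space_mu: "0 < a \<Longrightarrow> a < 1 \<Longrightarrow> prob_space (mu n a)"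
  unfolding mu_def by (intro prob_space_PiM prob_space_sign_measure)

text \<open>Every function on the cube is integrable for \<open>mu n a\<close>, since every subset is measurable.\<close>

lemma sets_mu: "sets (mu n a) = Pow (cube n)"
proof -
  have "sets (mu n a) = sets (\<Pi>\<^sub>M i\<in>{..<n}. count_space {-1, 1::real})"
    unfolding mu_def by (intro sets_PiM_cong) (auto simp: sign_measure_def sets_point_measure)
  also have "\<dots> = Pow (cube n)"
    by (subst count_space_PiM_finite) (auto simp: cube_def countable_finite)
  finally show ?thesis .
qed

end

theory Submission imports Defs begin

text \<open>
  Write \<open>g = T\<^sub>a f\<close> and \<open>L = ln u\<close>, let \<open>y\<close> have density \<open>f\<close>, and let \<open>x\<close> be its noisy copy, so
  that \<open>x\<close> has density \<open>g\<close> and \<open>g x = (\<Prod>k. 1 + b\<^sub>k x\<^sub>k)\<close> with \<open>b\<^sub>k\<close> the mean of \<open>x\<^sub>k\<close> given the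
  earlier coordinates. Let \<open>h\<^sub>k = b\<^sub>k\<close> as long as \<open>\<Sum>b\<^sub>j\<^sup>2 \<le> 2 L\<close>, and \<open>h\<^sub>k = 0\<close> afterwards. On
  \<open>{g \<ge> u}\<close> the sum \<open>\<Sum>h\<^sub>k x\<^sub>k\<close> is at least \<open>L\<close> up to a martingale of size \<open>\<surd>L\<close>: without stopping
  because \<open>ln g x \<le> \<Sum>b\<^sub>k x\<^sub>k\<close>, and with stopping because \<open>\<Sum>h\<^sub>k\<^sup>2 \<ge> 2 L - 1\<close>. Conversely,
  integrating by parts in the noise shows that \<open>u\<close> times the uniform integral of \<open>\<Sum>h\<^sub>k x\<^sub>k\<close> over
  \<open>{g \<ge> u}\<close> is at most the expectation over \<open>{g \<ge> u}\<close> of the score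
  \<open>\<Sum>(h\<^sub>k + a \<bar>h\<^sub>k\<bar> y\<^sub>k) (x\<^sub>k - a y\<^sub>k) / (1 - a\<^sup>2)\<close>. Given \<open>y\<close> the score is again a martingale, so this
  is \<open>O(\<surd>L)\<close>. Comparing the two bounds yields the factor \<open>1 / \<surd>L\<close>.
\<close>

section \<open>Coordinate flips on the cube\<close>

definition flip :: "nat \<Rightarrow> (nat \<Rightarrow> real) \<Rightarrow> (nat \<Rightarrow> real)" where
  "flip k x = x(k := - x k)"

lemma flip_apply: "flip k x j = (if j = k then - x k else x j)"
  by (simp add: flip_def)

lemma flip_flip [simp]: "flip k (flip k x) = x"
  by (auto simp: flip_def)

lemma flip_commute: "flip k (flip j x) = flip j (flip k x)"
  by (auto simp: flip_def fun_eq_iff)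

lemma flip_in_cube: "k < n \<Longrightarrow> x \<in> cube n \<Longrightarrow> flip k x \<in> cube n"
  by (auto simp: cube_def flip_def PiE_iff extensional_def)

lemma cube_coord: "x \<in> cube n \<Longrightarrow> k < n \<Longrightarrow> x k = 1 \<or> x k = -1"
  by (auto simp: cube_def PiE_iff)

lemma cube_coord_sq: "x \<in> cube n \<Longrightarrow> k < n \<Longrightarrow> x k * x k = 1"
  using cube_coord by fastforce

lemma card_cube: "card (cube n) = 2 ^ n"
  by (simp add: cube_def card_PiE numeral_2_eq_2)

text \<open>Since \<open>flip k\<close> permutes the cube, averaging \<open>F\<close> over
  \<open>x\<close> and \<open>flip k x\<close> integrates out coordinate \<open>k\<close>. This
  plays the part of a conditional expectation in the computations below.\<close>

lemma sum_flip_average: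
  fixes F :: "(nat \<Rightarrow> real) \<Rightarrow> real"
  assumes "k < n"
  shows "(\<Sum>x\<in>cube n. F x) = (\<Sum>x\<in>cube n. (F x + F (flip k x)) / 2)"
proof -
  have "(\<Sum>x\<in>cube n. F (flip k x)) = (\<Sum>x\<in>cube n. F x)"
    by (rule sum.reindex_bij_witness[of _ "flip k" "flip k"]) (auto simp: flip_in_cube assms)
  then show ?thesis
    by (simp add: sum.distrib flip: sum_divide_distrib)
qed

section \<open>Predictable sequences and the variance of martingales\<close>

text \<open>Invariance under flips replaces a filtration: \<open>b k\<close> is a function of the
  coordinates strictly before \<open>k\<close>, because \<open>j = k\<close> is included.\<close>

definition predictable :: "nat \<Rightarrow> (nat \<Rightarrow> (nat \<Rightarrow> real) \<Rightarrow> real) \<Rightarrow> bool" where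
  "predictable n b \<longleftrightarrow> (\<forall>k j x. k \<le> j \<longrightarrow> j < n \<longrightarrow> x \<in> cube n \<longrightarrow> b k (flip j x) = b k x)"

lemma predictableD:
  "predictable n b \<Longrightarrow> k \<le> j \<Longrightarrow> j < n \<Longrightarrow> x \<in> cube n \<Longrightarrow> b k (flip j x) = b k x"
  by (auto simp: predictable_def)

text \<open>Under the weight, \<open>x k\<close> has conditional mean \<open>b k x\<close> and
  conditional variance \<open>1 - (b k x)\<^sup>2\<close>. The summands on the left are thus
  martingale differences, whose cross terms vanish.\<close>

lemma martingale_second_moment:
  assumes b: "predictable n b" and h: "predictable n h" and "m \<le> n"
  shows "(\<Sum>x\<in>cube n. (\<Prod>k<m. 1 + b k x * x k) * (\<Sum>k<m. h k x * (x k - b k x))\<^sup>2) =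
         (\<Sum>x\<in>cube n. (\<Prod>k<m. 1 + b k x * x k) * (\<Sum>k<m. (h k x)\<^sup>2 * (1 - (b k x)\<^sup>2)))"
  using \<open>m \<le> n\<close>
proof (induction m)
  case 0
  show ?case by simp
next
  case (Suc m)
  then have m: "m < n" by simp
  define W where "W x = (\<Prod>k<m. 1 + b k x * x k)" for x
  define V where "V x = (\<Sum>k<m. h k x * (x k - b k x))" for x
  define Q where "Q x = (\<Sum>k<m. (h k x)\<^sup>2 * (1 - (b k x)\<^sup>2))" for x
  have inv: "W (flip m x) = W x" "V (flip m x) = V x" "Q (flip m x) = Q x"
    "b m (flip m x) = b m x" "h m (flip m x) = h m x" if "x \<in> cube n" for x
    using that m unfolding W_def V_def Q_def
    by (auto intro!: prod.cong sum.cong simp: predictableD[OF b] predictableD[OF h] flip_apply)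
  define d where "d x = W x * ((h m x)\<^sup>2 * (1 - (b m x)\<^sup>2))" for x
  \<comment> \<open>\<open>W\<close>, \<open>V\<close>, \<open>b m\<close> and \<open>h m\<close>
    ignore coordinate \<open>m\<close>, so averaging over its flip removes the cross term and leaves
    the conditional variance \<open>d\<close>.\<close>
  have "(\<Sum>x\<in>cube n. W x * (1 + b m x * x m) * (V x + h m x * (x m - b m x))\<^sup>2) =
        (\<Sum>x\<in>cube n. W x * (V x)\<^sup>2 + d x)"
  proof (subst sum_flip_average[OF m], rule sum.cong[OF refl])
    fix x assume x: "x \<in> cube n"
    show "(W x * (1 + b m x * x m) * (V x + h m x * (x m - b m x))\<^sup>2 +
        W (flip m x) * (1 + b m (flip m x) * flip m x m) *
        (V (flip m x) + h m (flip m x) * (flip m x m - b m (flip m x)))\<^sup>2) / 2 =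
        W x * (V x)\<^sup>2 + d x"
      using cube_coord[OF x m]
      by (auto simp: inv[OF x] d_def flip_apply power2_eq_square field_simps)
  qed
  also have "\<dots> = (\<Sum>x\<in>cube n. W x * Q x + d x)"
    using Suc m by (simp add: sum.distrib W_def V_def Q_def)
  \<comment> \<open>The bracket ignores coordinate \<open>m\<close>, and
    \<open>1 + b m x * x m\<close> averages to 1 over its flip, so this factor can be
    inserted.\<close>
  also have "\<dots> = (\<Sum>x\<in>cube n. W x * (1 + b m x * x m) *
      (Q x + (h m x)\<^sup>2 * (1 - (b m x)\<^sup>2)))"
  proof (subst (2) sum_flip_average[OF m], rule sum.cong[OF refl])
    fix x assume x: "x \<in> cube n"
    show "W x * Q x + d x = (W x * (1 + b m x * x m) * (Q x + (h m x)\<^sup>2 * (1 - (b m x)\<^sup>2)) +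
        W (flip m x) * (1 + b m (flip m x) * flip m x m) *
        (Q (flip m x) + (h m (flip m x))\<^sup>2 * (1 - (b m (flip m x))\<^sup>2))) / 2"
      using cube_coord[OF x m]
      by (auto simp: inv[OF x] d_def flip_apply power2_eq_square field_simps)
  qed
  finally show ?case
    by (simp add: W_def V_def Q_def)
qed

section \<open>The noise kernel and integration by parts\<close>

text \<open>For \<open>0 < a < 1\<close>, the uniform density at \<open>x\<close> of a noisy copy of
  \<open>y\<close> that keeps each sign independently with probability
  \<open>(1 + a) / 2\<close>.\<close>

definition noise_kernel :: "nat \<Rightarrow> real \<Rightarrow> (nat \<Rightarrow> real) \<Rightarrow> (nat \<Rightarrow> real) \<Rightarrow> real" where
  "noise_kernel n a x y = (\<Prod>k<n. 1 + a * x k * y k)"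

definition noise_op :: "nat \<Rightarrow> real \<Rightarrow> ((nat \<Rightarrow> real) \<Rightarrow> real) \<Rightarrow> (nat \<Rightarrow> real) \<Rightarrow> real" where
  "noise_op n a f x = (\<Sum>y\<in>cube n. f y * noise_kernel n a x y) / 2 ^ n"

lemma noise_kernel_nonneg:
  assumes "\<bar>a\<bar> \<le> 1" "x \<in> cube n" "y \<in> cube n"
  shows "0 \<le> noise_kernel n a x y"
  unfolding noise_kernel_def
proof (rule prod_nonneg)
  fix k assume "k \<in> {..<n}"
  then show "0 \<le> 1 + a * x k * y k"
    using cube_coord[OF assms(2), of k] cube_coord[OF assms(3), of k] assms(1) by auto
qed

lemma noise_kernel_split:
  assumes "k < n"
  shows "noise_kernel n a x y = (\<Prod>j\<in>{..<n} - {k}. 1 + a * x j * y j) * (1 + a * x k * y k)"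
    and "noise_kernel n a (flip k x) y =
      (\<Prod>j\<in>{..<n} - {k}. 1 + a * x j * y j) * (1 - a * x k * y k)"
  using assms by (simp_all add: noise_kernel_def prod.remove[of "{..<n}" k] flip_apply mult.commute)

text \<open>
  Only pairs of neighbours \<open>x\<close>, \<open>flip k x\<close> that straddle the level \<open>u\<close> contribute. On such a pair
  \<open>u\<close> differs from the average of \<open>g\<close> by at most \<open>\<bar>g x - g (flip k x)\<bar> / 2\<close>, and the part
  \<open>a * \<bar>h x\<bar> * y k\<close> of the weight compensates exactly for this error, since \<open>y k\<close> has the
  sign of \<open>g x - g (flip k x)\<close> on average.
\<close>

lemma level_set_integration_by_parts:
  fixes f :: "(nat \<Rightarrow> real) \<Rightarrow> real" and n :: nat and a :: real
  defines "g \<equiv> noise_op n a f"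
  assumes a: "\<bar>a\<bar> \<le> 1" and k: "k < n" and h: "\<And>x. x \<in> cube n \<Longrightarrow> h (flip k x) = h x"
  shows "(1 - a\<^sup>2) * 2 ^ n * (u * (\<Sum>x\<in>cube n. of_bool (u \<le> g x) * (h x * x k))) \<le>
    (\<Sum>x\<in>cube n. \<Sum>y\<in>cube n. f y * noise_kernel n a x y *
       (of_bool (u \<le> g x) * ((h x + a * \<bar>h x\<bar> * y k) * (x k - a * y k))))"
    (is "?l \<le> (\<Sum>x\<in>_. ?R x)")
proof -
  define \<theta> :: "(nat \<Rightarrow> real) \<Rightarrow> real" where "\<theta> x = of_bool (u \<le> g x)" for x
  have "?l = (\<Sum>x\<in>cube n. (1 - a\<^sup>2) * 2 ^ n * (u * (\<theta> x * (h x * x k))))"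
    by (simp add: sum_distrib_left \<theta>_def)
  also have "\<dots> = (\<Sum>x\<in>cube n. (1 - a\<^sup>2) * 2 ^ n * (u * h x * x k * (\<theta> x - \<theta> (flip k x))) / 2)"
    by (subst sum_flip_average[OF k], rule sum.cong) (auto simp: h flip_apply algebra_simps)
  also have "\<dots> \<le> (\<Sum>x\<in>cube n. (?R x + ?R (flip k x)) / 2)"
  proof (rule sum_mono)
    fix x assume x: "x \<in> cube n"
    let ?x = "flip k x"
    let ?P = "noise_kernel n a"
    \<comment> \<open>For signs, \<open>(x k - a * y k) * (1 + a * x k * y k) = (1 - a\<^sup>2) * x
      k\<close>. The product over the other coordinates is the mean of the two kernel values, and
      \<open>a * x k * y k\<close> times it is half their difference.\<close>
    have kernel: "?P x y * (\<theta> x * ((h x + a * \<bar>h x\<bar> * y k) * (x k - a * y k))) +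
        ?P ?x y * (\<theta> ?x * ((h ?x + a * \<bar>h ?x\<bar> * y k) * (?x k - a * y k))) =
        (1 - a\<^sup>2) * (\<theta> x - \<theta> ?x) * (h x * x k * (?P x y + ?P ?x y) / 2 + \<bar>h x\<bar> * (?P x y - ?P ?x y) / 2)"
      if y: "y \<in> cube n" for y
      using cube_coord[OF x k] cube_coord[OF y k]
      unfolding noise_kernel_split[OF k, of a x y] h[OF x]
      by (auto simp: flip_apply power2_eq_square algebra_simps)
    have "?R x + ?R ?x = (\<Sum>y\<in>cube n. f y * (
        ?P x y * (\<theta> x * ((h x + a * \<bar>h x\<bar> * y k) * (x k - a * y k))) +
        ?P ?x y * (\<theta> ?x * ((h ?x + a * \<bar>h ?x\<bar> * y k) * (?x k - a * y k)))))"
      unfolding \<theta>_def by (simp only: sum.distrib[symmetric] distrib_left mult.assoc)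
    also have "\<dots> = (\<Sum>y\<in>cube n. f y * ((1 - a\<^sup>2) * (\<theta> x - \<theta> ?x) *
        (h x * x k * (?P x y + ?P ?x y) / 2 + \<bar>h x\<bar> * (?P x y - ?P ?x y) / 2)))"
      by (intro sum.cong refl) (simp only: kernel)
    also have "\<dots> = (\<Sum>y\<in>cube n. (1 - a\<^sup>2) * (\<theta> x - \<theta> ?x) * ((h x * x k + \<bar>h x\<bar>) / 2) * (f y * ?P x y)
        + (1 - a\<^sup>2) * (\<theta> x - \<theta> ?x) * ((h x * x k - \<bar>h x\<bar>) / 2) * (f y * ?P ?x y))"
      by (intro sum.cong refl) (simp add: field_simps)
    also have "\<dots> = (1 - a\<^sup>2) * (\<theta> x - \<theta> ?x) * ((h x * x k + \<bar>h x\<bar>) / 2) * (2 ^ n * g x)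
        + (1 - a\<^sup>2) * (\<theta> x - \<theta> ?x) * ((h x * x k - \<bar>h x\<bar>) / 2) * (2 ^ n * g ?x)"
      by (simp only: sum.distrib sum_distrib_left[symmetric]) (simp add: g_def noise_op_def)
    also have "\<dots> = (1 - a\<^sup>2) * 2 ^ n * ((\<theta> x - \<theta> ?x) *
        (h x * x k * (g x + g ?x) / 2 + \<bar>h x\<bar> * (g x - g ?x) / 2))"
      by (simp add: field_simps)
    finally have R: "?R x + ?R ?x = (1 - a\<^sup>2) * 2 ^ n * ((\<theta> x - \<theta> ?x) *
        (h x * x k * (g x + g ?x) / 2 + \<bar>h x\<bar> * (g x - g ?x) / 2))" .
    have "h x * x k * (u - (g x + g ?x) / 2) * (\<theta> x - \<theta> ?x) \<le>
        \<bar>h x * x k * (u - (g x + g ?x) / 2) * (\<theta> x - \<theta> ?x)\<bar>"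
      by (rule abs_ge_self)
    also have "\<dots> = \<bar>h x\<bar> * (\<bar>u - (g x + g ?x) / 2\<bar> * \<bar>\<theta> x - \<theta> ?x\<bar>)"
      using cube_coord[OF x k] by (auto simp: abs_mult)
    also have "\<dots> \<le> \<bar>h x\<bar> * ((g x - g ?x) / 2 * (\<theta> x - \<theta> ?x))"
      by (intro mult_left_mono) (auto simp: \<theta>_def abs_if field_simps)
    finally have "u * h x * x k * (\<theta> x - \<theta> ?x) \<le>
        (\<theta> x - \<theta> ?x) * (h x * x k * (g x + g ?x) / 2 + \<bar>h x\<bar> * (g x - g ?x) / 2)"
      by (simp add: field_simps)
    moreover have "0 \<le> (1 - a\<^sup>2) * 2 ^ n"
      using a by (simp add: abs_square_le_1)
    ultimately show "(1 - a\<^sup>2) * 2 ^ n * (u * h x * x k * (\<theta> x - \<theta> ?x)) / 2 \<le> (?R x + ?R ?x) / 2"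
      unfolding R by (intro divide_right_mono mult_left_mono) auto
  qed
  also have "\<dots> = (\<Sum>x\<in>cube n. ?R x)"
    by (rule sum_flip_average[OF k, symmetric])
  finally show ?thesis .
qed

lemma sum_noise_kernel: "(\<Sum>x\<in>cube n. noise_kernel n a x y) = 2 ^ n"
proof -
  have "(\<Sum>x\<in>cube n. noise_kernel n a x y) = (\<Prod>k<n. \<Sum>s\<in>{-1, 1}. 1 + a * s * y k)"
    unfolding noise_kernel_def cube_def by (rule prod_sum_PiE[symmetric]) auto
  then show ?thesis by simp
qed

section \<open>Factorization of a density into conditional factors\<close>

text \<open>The uniform conditional expectation of \<open>g\<close> given the first \<open>k\<close>
  coordinates: for \<open>k \<le> n\<close> the cylinder has \<open>2 ^ (n - k)\<close>
  points.\<close>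

definition partial_mean :: "nat \<Rightarrow> ((nat \<Rightarrow> real) \<Rightarrow> real) \<Rightarrow> nat \<Rightarrow> (nat \<Rightarrow> real) \<Rightarrow> real" where
  "partial_mean n g k x = (\<Sum>x' | x' \<in> cube n \<and> (\<forall>i<k. x' i = x i). g x') * 2 ^ k / 2 ^ n"

text \<open>The conditional mean of coordinate \<open>k\<close> under the density \<open>g\<close>,
  given the earlier ones. Where both partial means vanish, division by zero makes it 0.\<close>

definition bias :: "nat \<Rightarrow> ((nat \<Rightarrow> real) \<Rightarrow> real) \<Rightarrow> nat \<Rightarrow> (nat \<Rightarrow> real) \<Rightarrow> real" where
  "bias n g k x =
     x k * (partial_mean n g (Suc k) x - partial_mean n g (Suc k) (flip k x)) /
     (partial_mean n g (Suc k) x + partial_mean n g (Suc k) (flip k x))"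

lemma partial_mean_0: "partial_mean n g 0 x = (\<Sum>x\<in>cube n. g x) / 2 ^ n"
  by (simp add: partial_mean_def)

lemma partial_mean_full:
  assumes "x \<in> cube n"
  shows "partial_mean n g n x = g x"
proof -
  have "x' = x" if "x' \<in> cube n" "\<forall>i<n. x' i = x i" for x'
    using that assms by (intro PiE_ext[of x' "{..<n}" "\<lambda>_. {-1, 1}" x]) (auto simp: cube_def)
  then have "{x'. x' \<in> cube n \<and> (\<forall>i<n. x' i = x i)} = {x}"
    using assms by auto
  then show ?thesis by (simp add: partial_mean_def)
qed

lemma partial_mean_flip: "k \<le> j \<Longrightarrow> partial_mean n g k (flip j x) = partial_mean n g k x"
  by (simp add: partial_mean_def flip_apply cong: conj_cong)

lemma partial_mean_nonneg:
  "(\<And>x. x \<in> cube n \<Longrightarrow> 0 \<le> g x) \<Longrightarrow> 0 \<le> partial_mean n g k x"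
  unfolding partial_mean_def by (intro divide_nonneg_nonneg mult_nonneg_nonneg sum_nonneg) auto

text \<open>The martingale property under the uniform measure: coordinate \<open>k\<close> cuts the
  cylinder into two disjoint halves.\<close>

lemma partial_mean_average:
  assumes k: "k < n" and x: "x \<in> cube n"
  shows "partial_mean n g k x =
    (partial_mean n g (Suc k) x + partial_mean n g (Suc k) (flip k x)) / 2"
proof -
  let ?A = "\<lambda>k x. {x'. x' \<in> cube n \<and> (\<forall>i<k. x' i = x i)}"
  have "?A k x = ?A (Suc k) x \<union> ?A (Suc k) (flip k x)"
    using cube_coord[OF x k] cube_coord[OF _ k] by (fastforce simp: less_Suc_eq flip_apply)
  moreover have "?A (Suc k) x \<inter> ?A (Suc k) (flip k x) = {}"
    using cube_coord[OF x k] by (auto simp: flip_apply)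
  ultimately have "sum g (?A k x) = sum g (?A (Suc k) x) + sum g (?A (Suc k) (flip k x))"
    using finite_cube[of n] by (simp add: sum.union_disjoint)
  then show ?thesis by (simp add: partial_mean_def field_simps)
qed

lemma predictable_bias: "predictable n (bias n g)"
  unfolding predictable_def
proof (intro allI impI)
  fix k j x assume "k \<le> j" "j < n" "x \<in> cube n"
  show "bias n g k (flip j x) = bias n g k x"
  proof (cases "k = j")
    \<comment> \<open>Both \<open>x k\<close> and the difference of the partial means change
      sign.\<close>
    case True
    then show ?thesis by (simp add: bias_def flip_apply algebra_simps minus_divide_left)
  next
    case False
    with \<open>k \<le> j\<close> show ?thesis
      by (simp add: bias_def flip_apply flip_commute[of k j] partial_mean_flip)
  qed
qed

context
  fixes n :: nat and g :: "(nat \<Rightarrow> real) \<Rightarrow> real"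
  assumes g_nonneg: "\<And>x. x \<in> cube n \<Longrightarrow> 0 \<le> g x"
begin

lemma abs_bias_le_1:
  assumes "x \<in> cube n" "k < n"
  shows "\<bar>bias n g k x\<bar> \<le> 1"
proof -
  let ?p = "partial_mean n g (Suc k) x" and ?q = "partial_mean n g (Suc k) (flip k x)"
  have "0 \<le> ?p" "0 \<le> ?q"
    using g_nonneg by (auto intro: partial_mean_nonneg)
  then have "\<bar>?p - ?q\<bar> / (?p + ?q) \<le> 1"
    by (auto simp: divide_le_eq_1)
  then show ?thesis
    using cube_coord[OF assms] \<open>0 \<le> ?p\<close> \<open>0 \<le> ?q\<close>
    by (auto simp: bias_def abs_mult abs_minus_commute)
qed

lemma partial_mean_Suc:
  assumes x: "x \<in> cube n" and k: "k < n"
  shows "partial_mean n g (Suc k) x = partial_mean n g k x * (1 + bias n g k x * x k)"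
proof -
  let ?p = "partial_mean n g (Suc k) x" and ?q = "partial_mean n g (Suc k) (flip k x)"
  have pq: "0 \<le> ?p" "0 \<le> ?q"
    using g_nonneg by (auto intro: partial_mean_nonneg)
  have "bias n g k x * x k = (?p - ?q) / (?p + ?q)"
    using cube_coord[OF x k] by (auto simp: bias_def)
  \<comment> \<open>If \<open>?p + ?q = 0\<close>, nonnegativity makes both zero, and the identity
    reads \<open>0 = 0\<close>.\<close>
  then show ?thesis
    using pq by (cases "?p + ?q = 0") (auto simp: partial_mean_average[OF k x] field_simps)
qed

text \<open>The chain rule for densities: \<open>partial_mean_Suc\<close> telescopes from the total
  mean 1 up to \<open>g x\<close>.\<close>

lemma density_eq_prod_bias:
  assumes total: "(\<Sum>x\<in>cube n. g x) = 2 ^ n" and x: "x \<in> cube n"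
  shows "g x = (\<Prod>k<n. 1 + bias n g k x * x k)"
proof -
  have "partial_mean n g m x = (\<Prod>k<m. 1 + bias n g k x * x k)" if "m \<le> n" for m
    using that by (induction m) (simp_all add: partial_mean_0 total partial_mean_Suc[OF x])
  from this[of n] show ?thesis by (simp add: partial_mean_full[OF x])
qed

end

section \<open>Stopping at a variance budget\<close>

text \<open>The test includes the term \<open>k\<close> itself. The budget \<open>s\<close> is
  therefore never overshot, and predictability survives because \<open>b k\<close> is known before
  \<open>x k\<close>.\<close>

definition stopped ::
  "real \<Rightarrow> (nat \<Rightarrow> (nat \<Rightarrow> real) \<Rightarrow> real) \<Rightarrow> nat \<Rightarrow> (nat \<Rightarrow> real) \<Rightarrow> real" where
  "stopped s b k x = (if (\<Sum>j\<le>k. (b j x)\<^sup>2) \<le> s then b k x else 0)"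

lemma predictable_stopped:
  assumes "predictable n b"
  shows "predictable n (stopped s b)"
  using assms by (simp add: predictable_def stopped_def)

lemma stopped_mult_self: "stopped s b k x * b k x = (stopped s b k x)\<^sup>2"
  by (simp add: stopped_def power2_eq_square)

lemma sum_stopped_le:
  assumes "0 \<le> s"
  shows "(\<Sum>k<m. (stopped s b k x)\<^sup>2) \<le> s"
proof (induction m)
  case 0
  show ?case using assms by simp
next
  case (Suc m)
  have "(\<Sum>k<m. (stopped s b k x)\<^sup>2) \<le> (\<Sum>k<m. (b k x)\<^sup>2)"
    by (intro sum_mono) (simp add: stopped_def)
  \<comment> \<open>If term \<open>m\<close> is kept, the unstopped sum through \<open>m\<close> is
    within \<open>s\<close> and dominates; otherwise nothing is added.\<close>
  with Suc show ?case
    by (auto simp: stopped_def lessThan_Suc_atMost[symmetric])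
qed

lemma stopped_eq_self:
  assumes "(\<Sum>k<n. (b k x)\<^sup>2) \<le> s" "k < n"
  shows "stopped s b k x = b k x"
proof -
  have "(\<Sum>j\<le>k. (b j x)\<^sup>2) \<le> (\<Sum>j<n. (b j x)\<^sup>2)"
    using assms(2) by (intro sum_mono2) auto
  with assms(1) show ?thesis by (simp add: stopped_def)
qed

text \<open>The first rejected square is at most 1, so the terms kept before it already sum to more
  than \<open>s - 1\<close>.\<close>

lemma sum_stopped_ge:
  assumes b: "\<And>k. k < n \<Longrightarrow> \<bar>b k x\<bar> \<le> 1"
  shows "min (\<Sum>k<n. (b k x)\<^sup>2) (s - 1) \<le> (\<Sum>k<n. (stopped s b k x)\<^sup>2)"
  using b
proof (induction n)
  case 0
  show ?case by simp
next
  case (Suc n)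
  show ?case
  proof (cases "(\<Sum>k<Suc n. (b k x)\<^sup>2) \<le> s")
    case True
    then have "(\<Sum>k<Suc n. (stopped s b k x)\<^sup>2) = (\<Sum>k<Suc n. (b k x)\<^sup>2)"
      by (intro sum.cong) (simp_all only: lessThan_iff stopped_eq_self)
    then show ?thesis by simp
  next
    case False
    moreover have "(b n x)\<^sup>2 \<le> 1"
      using Suc.prems[of n] by (simp add: abs_square_le_1)
    moreover have "stopped s b n x = 0"
      using False by (simp add: stopped_def lessThan_Suc_atMost[symmetric])
    ultimately show ?thesis
      using Suc by simp
  qed
qed

section \<open>First moments and the tail of the noise operator\<close>

text \<open>A weighted Cauchy-Schwarz bound, obtained by summing
  \<open>\<bar>Z\<bar> \<le> (c + Z\<^sup>2 / c) / 2\<close>.\<close>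

lemma sum_mult_abs_le:
  fixes w Z :: "'a \<Rightarrow> real"
  assumes w: "\<And>i. i \<in> A \<Longrightarrow> 0 \<le> w i" and c: "0 < c"
    and le: "(\<Sum>i\<in>A. w i * (Z i)\<^sup>2) \<le> c\<^sup>2 * (\<Sum>i\<in>A. w i)"
  shows "(\<Sum>i\<in>A. w i * \<bar>Z i\<bar>) \<le> c * (\<Sum>i\<in>A. w i)"
proof -
  have "(\<Sum>i\<in>A. w i * \<bar>Z i\<bar>) \<le> (\<Sum>i\<in>A. (c * w i + w i * (Z i)\<^sup>2 / c) / 2)"
  proof (rule sum_mono)
    fix i assume i: "i \<in> A"
    have "0 \<le> (\<bar>Z i\<bar> - c)\<^sup>2" by simp
    then have "\<bar>Z i\<bar> \<le> (c + (Z i)\<^sup>2 / c) / 2"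
      using c by (simp add: power2_eq_square field_simps)
    from mult_left_mono[OF this w[OF i]]
    show "w i * \<bar>Z i\<bar> \<le> (c * w i + w i * (Z i)\<^sup>2 / c) / 2"
      by (simp add: field_simps)
  qed
  also have "\<dots> = (c * (\<Sum>i\<in>A. w i) + (\<Sum>i\<in>A. w i * (Z i)\<^sup>2) / c) / 2"
    by (simp add: sum.distrib sum_distrib_left flip: sum_divide_distrib)
  also have "\<dots> \<le> (c * (\<Sum>i\<in>A. w i) + c\<^sup>2 * (\<Sum>i\<in>A. w i) / c) / 2"
    using le c by (intro divide_right_mono add_left_mono) auto
  also have "\<dots> = c * (\<Sum>i\<in>A. w i)"
    using c by (simp add: power2_eq_square)
  finally show ?thesis .
qed

lemma noise_op_nonneg:
  assumes "\<bar>a\<bar> \<le> 1" "\<And>y. y \<in> cube n \<Longrightarrow> 0 \<le> f y" "x \<in> cube n"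
  shows "0 \<le> noise_op n a f x"
  using assms by (auto simp: noise_op_def intro!: divide_nonneg_nonneg sum_nonneg mult_nonneg_nonneg noise_kernel_nonneg)

lemma sum_noise_op: "(\<Sum>x\<in>cube n. noise_op n a f x) = (\<Sum>y\<in>cube n. f y)"
proof -
  have "(\<Sum>x\<in>cube n. \<Sum>y\<in>cube n. f y * noise_kernel n a x y) =
      (\<Sum>y\<in>cube n. f y * (\<Sum>x\<in>cube n. noise_kernel n a x y))"
    by (subst sum.swap) (simp add: sum_distrib_left)
  then show ?thesis
    by (simp add: noise_op_def sum_noise_kernel flip: sum_divide_distrib sum_distrib_right)
qed

lemma noise_op_tail:
  assumes a: "0 < a" "a < 1" and u: "0 < u" "1 \<le> ln u"
    and f: "\<And>x. x \<in> cube n \<Longrightarrow> 0 \<le> f x" and total: "(\<Sum>x\<in>cube n. f x) = 2 ^ n"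
  shows "u * real (card {x \<in> cube n. u \<le> noise_op n a f x}) / 2 ^ n \<le> 5 / sqrt ((1 - a\<^sup>2) * ln u)"
proof -
  define g where "g = noise_op n a f"
  define L where "L = ln u"
  define e where "e = 1 - a\<^sup>2"
  define \<theta> :: "(nat \<Rightarrow> real) \<Rightarrow> real" where "\<theta> x = of_bool (u \<le> g x)" for x
  define b where "b = bias n g"
  \<comment> \<open>The budget \<open>2 * L\<close> leaves at least \<open>2 * L - 1 \<ge> L\<close>
    after the possible loss of 1, while keeping the variance \<open>O(L)\<close>.\<close>
  define h where "h = stopped (2 * L) b"
  define S where "S x = (\<Sum>k<n. h k x * x k)" for x
  define V where "V x = (\<Sum>k<n. h k x * (x k - b k x))" for x
  define h' where "h' k x y = h k x + a * \<bar>h k x\<bar> * y k" for k and x y :: "nat \<Rightarrow> real"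
  define N where "N x y = (\<Sum>k<n. h' k x y * (x k - a * y k))" for x y
  let ?P = "noise_kernel n a"
  have L: "1 \<le> L" using u by (simp add: L_def)
  have e: "0 < e" "e \<le> 1" using a by (auto simp: e_def power_less_one_iff abs_square_less_1)
  have g_nonneg: "0 \<le> g x" if "x \<in> cube n" for x
    using a that by (auto simp: g_def intro: noise_op_nonneg f)
  have g_total: "(\<Sum>x\<in>cube n. g x) = 2 ^ n"
    by (simp add: g_def sum_noise_op total)
  have b: "predictable n b"
    by (simp add: b_def predictable_bias)
  then have h: "predictable n h"
    by (simp add: h_def predictable_stopped)
  have g_eq: "g x = (\<Prod>k<n. 1 + b k x * x k)" if "x \<in> cube n" for x
    unfolding b_def by (rule density_eq_prod_bias[OF g_nonneg g_total that])
  have b_le: "\<bar>b k x\<bar> \<le> 1" if "x \<in> cube n" "k < n" for k x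
    unfolding b_def by (rule abs_bias_le_1[OF g_nonneg that])
  have h_le: "(\<Sum>k<n. (h k x)\<^sup>2) \<le> 2 * L" for x
    unfolding h_def using L by (intro sum_stopped_le) simp

  have "e * 2 ^ n * (u * (\<Sum>x\<in>cube n. \<theta> x * S x)) =
      (\<Sum>k<n. e * 2 ^ n * (u * (\<Sum>x\<in>cube n. \<theta> x * (h k x * x k))))"
  proof -
    have "(\<Sum>x\<in>cube n. \<theta> x * S x) = (\<Sum>k<n. \<Sum>x\<in>cube n. \<theta> x * (h k x * x k))"
      unfolding S_def sum_distrib_left by (rule sum.swap)
    then show ?thesis by (simp add: sum_distrib_left)
  qed
  \<comment> \<open>Being predictable, \<open>h k\<close> is unchanged by \<open>flip k\<close>, so
    integration by parts applies in every coordinate.\<close>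
  also have "\<dots> \<le> (\<Sum>k<n. \<Sum>x\<in>cube n. \<Sum>y\<in>cube n. f y * ?P x y *
      (\<theta> x * (h' k x y * (x k - a * y k))))"
    unfolding e_def \<theta>_def g_def h'_def
    using a by (intro sum_mono level_set_integration_by_parts) (auto intro: predictableD[OF h])
  also have "\<dots> = (\<Sum>x\<in>cube n. \<Sum>y\<in>cube n. f y * ?P x y * (\<theta> x * N x y))"
  proof -
    have "(\<Sum>k<n. \<Sum>x\<in>cube n. \<Sum>y\<in>cube n. f y * ?P x y * (\<theta> x * (h' k x y * (x k - a * y k)))) =
        (\<Sum>x\<in>cube n. \<Sum>k<n. \<Sum>y\<in>cube n. f y * ?P x y * (\<theta> x * (h' k x y * (x k - a * y k))))"
      by (rule sum.swap)
    also have "\<dots> = (\<Sum>x\<in>cube n. \<Sum>y\<in>cube n. f y * ?P x y * (\<theta> x * N x y))"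
      unfolding N_def sum_distrib_left by (intro sum.cong refl sum.swap)
    finally show ?thesis .
  qed
  also have "\<dots> \<le> (\<Sum>x\<in>cube n. \<Sum>y\<in>cube n. f y * ?P x y * \<bar>N x y\<bar>)"
    using a f by (intro sum_mono mult_left_mono) (auto simp: \<theta>_def intro!: mult_nonneg_nonneg noise_kernel_nonneg)
  \<comment> \<open>The 8 is 4 times 2: \<open>(h' k x y)\<^sup>2 \<le> 4 * (h k x)\<^sup>2\<close>,
    and the squares of \<open>h\<close> sum to at most \<open>2 * L\<close>. Each coordinate has
    conditional variance \<open>e\<close>.\<close>
  also have "\<dots> \<le> sqrt (8 * L * e) * (2 ^ n * 2 ^ n)"
  proof -
    have mass: "(\<Sum>x\<in>cube n. \<Sum>y\<in>cube n. f y * ?P x y) = 2 ^ n * 2 ^ n"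
      using g_total by (simp add: g_def noise_op_def flip: sum_divide_distrib)
        (simp add: field_simps)
    have "(\<Sum>x\<in>cube n. \<Sum>y\<in>cube n. f y * ?P x y * (N x y)\<^sup>2) =
        (\<Sum>y\<in>cube n. f y * (\<Sum>x\<in>cube n. ?P x y * (N x y)\<^sup>2))"
      by (subst sum.swap) (simp add: sum_distrib_left mult.assoc)
    also have "\<dots> \<le> (\<Sum>y\<in>cube n. f y * (\<Sum>x\<in>cube n. ?P x y * (8 * L * e)))"
    proof (rule sum_mono, rule mult_left_mono)
      fix y assume y: "y \<in> cube n"
      \<comment> \<open>With \<open>y\<close> fixed, the kernel is the product weight with constant
        biases \<open>a * y k\<close>, and \<open>h'\<close> is still predictable in
        \<open>x\<close>.\<close>
      have "(\<Sum>x\<in>cube n. ?P x y * (N x y)\<^sup>2) =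
          (\<Sum>x\<in>cube n. ?P x y * (\<Sum>k<n. (h' k x y)\<^sup>2 * (1 - (a * y k)\<^sup>2)))"
        using martingale_second_moment[of n "\<lambda>k x. a * y k" "\<lambda>k x. h' k x y" n] h
        by (simp add: N_def noise_kernel_def h'_def predictable_def ac_simps)
      also have "\<dots> \<le> (\<Sum>x\<in>cube n. ?P x y * (8 * L * e))"
      proof (rule sum_mono, rule mult_left_mono)
        fix x assume x: "x \<in> cube n"
        have "(\<Sum>k<n. (h' k x y)\<^sup>2 * (1 - (a * y k)\<^sup>2)) \<le> (\<Sum>k<n. 4 * e * (h k x)\<^sup>2)"
        proof (rule sum_mono)
          fix k assume "k \<in> {..<n}"
          then have y': "y k = 1 \<or> y k = -1"
            using cube_coord[OF y] by simp
          have "\<bar>h' k x y\<bar> \<le> \<bar>h k x\<bar> + \<bar>a * \<bar>h k x\<bar> * y k\<bar>"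
            unfolding h'_def by (rule abs_triangle_ineq)
          also have "\<bar>a * \<bar>h k x\<bar> * y k\<bar> \<le> \<bar>h k x\<bar>"
            using a y' by (auto simp: abs_mult intro!: mult_left_le_one_le)
          finally have "\<bar>h' k x y\<bar> \<le> \<bar>2 * h k x\<bar>" by simp
          then have "(h' k x y)\<^sup>2 \<le> 4 * (h k x)\<^sup>2"
            by (simp add: abs_le_square_iff power_mult_distrib)
          from mult_right_mono[OF this less_imp_le[OF e(1)]]
          have "(h' k x y)\<^sup>2 * e \<le> 4 * e * (h k x)\<^sup>2"
            by (simp add: mult_ac)
          moreover have "1 - (a * y k)\<^sup>2 = e"
            using y' by (auto simp: e_def)
          ultimately show "(h' k x y)\<^sup>2 * (1 - (a * y k)\<^sup>2) \<le> 4 * e * (h k x)\<^sup>2"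
            by simp
        qed
        also have "\<dots> = 4 * e * (\<Sum>k<n. (h k x)\<^sup>2)"
          by (simp add: sum_distrib_left)
        also have "\<dots> \<le> 4 * e * (2 * L)"
          using e h_le by (intro mult_left_mono) auto
        finally show "(\<Sum>k<n. (h' k x y)\<^sup>2 * (1 - (a * y k)\<^sup>2)) \<le> 8 * L * e"
          by (simp add: mult_ac)
        show "0 \<le> ?P x y"
          using a x y by (auto intro: noise_kernel_nonneg)
      qed
      finally show "(\<Sum>x\<in>cube n. ?P x y * (N x y)\<^sup>2) \<le> (\<Sum>x\<in>cube n. ?P x y * (8 * L * e))" .
      show "0 \<le> f y" by (rule f[OF y])
    qed
    also have "\<dots> = (sqrt (8 * L * e))\<^sup>2 * (2 ^ n * 2 ^ n)"
      using L e by (simp add: sum_noise_kernel total flip: sum_distrib_right)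
    finally have "(\<Sum>x\<in>cube n. \<Sum>y\<in>cube n. f y * ?P x y * (N x y)\<^sup>2) \<le>
        (sqrt (8 * L * e))\<^sup>2 * (2 ^ n * 2 ^ n)" .
    \<comment> \<open>The first-moment bound is used on pairs, weighted by the unnormalized joint
      law of \<open>x\<close> and \<open>y\<close>.\<close>
    then show ?thesis
      using sum_mult_abs_le[of "cube n \<times> cube n" "\<lambda>(x, y). f y * ?P x y" "sqrt (8 * L * e)" "\<lambda>(x, y). N x y"]
        a f L e mass
      by (auto simp: sum.cartesian_product case_prod_beta noise_kernel_nonneg)
  qed
  finally have upper: "e * (u * (\<Sum>x\<in>cube n. \<theta> x * S x)) \<le> sqrt (8 * L * e) * 2 ^ n"
    by simp

  \<comment> \<open>A second martingale, now under the law of \<open>x\<close> alone: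
    \<open>g\<close> is the product weight with biases \<open>b\<close>.\<close>
  have "(\<Sum>x\<in>cube n. g x * (V x)\<^sup>2) = (\<Sum>x\<in>cube n. g x * (\<Sum>k<n. (h k x)\<^sup>2 * (1 - (b k x)\<^sup>2)))"
    using martingale_second_moment[OF b h order_refl] by (simp add: g_eq V_def)
  also have "\<dots> \<le> (\<Sum>x\<in>cube n. g x * (2 * L))"
  proof (rule sum_mono, rule mult_left_mono)
    fix x assume "x \<in> cube n"
    then show "0 \<le> g x" by (rule g_nonneg)
    have "(\<Sum>k<n. (h k x)\<^sup>2 * (1 - (b k x)\<^sup>2)) \<le> (\<Sum>k<n. (h k x)\<^sup>2)"
      by (intro sum_mono) (simp add: algebra_simps)
    with h_le show "(\<Sum>k<n. (h k x)\<^sup>2 * (1 - (b k x)\<^sup>2)) \<le> 2 * L"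
      by (rule order_trans[rotated])
  qed
  also have "\<dots> = (sqrt (2 * L))\<^sup>2 * (\<Sum>x\<in>cube n. g x)"
    using L by (subst sum_distrib_right[symmetric]) simp
  finally have "(\<Sum>x\<in>cube n. g x * \<bar>V x\<bar>) \<le> sqrt (2 * L) * (\<Sum>x\<in>cube n. g x)"
    using L g_nonneg by (intro sum_mult_abs_le) auto
  then have V_le: "(\<Sum>x\<in>cube n. g x * \<bar>V x\<bar>) \<le> sqrt (2 * L) * 2 ^ n"
    by (simp add: g_total)

  have large: "L \<le> S x + \<bar>V x\<bar>" if x: "x \<in> cube n" and gx: "u \<le> g x" for x
  proof (cases "(\<Sum>k<n. (b k x)\<^sup>2) \<le> 2 * L")
    case True
    have "g x \<le> (\<Prod>k<n. exp (b k x * x k))"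
      unfolding g_eq[OF x]
    proof (rule prod_mono, intro conjI)
      fix k assume "k \<in> {..<n}"
      then show "0 \<le> 1 + b k x * x k"
        using b_le[OF x, of k] cube_coord[OF x, of k] by auto
    qed simp
    also have "\<dots> = exp (S x)"
      unfolding S_def h_def by (simp add: exp_sum stopped_eq_self[where b = b, OF True])
    finally have "u \<le> exp (S x)"
      using gx by simp
    then have "L \<le> S x"
      using u unfolding L_def by (metis exp_gt_zero ln_exp ln_le_cancel_iff)
    then show ?thesis by simp
  next
    case False
    have "2 * L - 1 \<le> (\<Sum>k<n. (h k x)\<^sup>2)"
      using sum_stopped_ge[of n b x "2 * L"] b_le[OF x] False by (simp add: h_def)
    \<comment> \<open>The compensator \<open>h k x * b k x\<close> equals
      \<open>(h k x)\<^sup>2\<close>, whether or not stopping has occurred.\<close>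
    also have "\<dots> = S x - V x"
      by (simp add: S_def V_def h_def right_diff_distrib sum_subtractf stopped_mult_self)
    finally show ?thesis
      using L by linarith
  qed
  define X where "X = u * (\<Sum>x\<in>cube n. \<theta> x) / 2 ^ n"
  have "L * (u * (\<Sum>x\<in>cube n. \<theta> x)) \<le> (\<Sum>x\<in>cube n. u * (\<theta> x * S x) + g x * \<bar>V x\<bar>)"
    unfolding sum_distrib_left
  proof (rule sum_mono)
    fix x assume x: "x \<in> cube n"
    show "L * (u * \<theta> x) \<le> u * (\<theta> x * S x) + g x * \<bar>V x\<bar>"
    proof (cases "u \<le> g x")
      case True
      have "u * L \<le> u * (S x + \<bar>V x\<bar>)"
        using u large[OF x True] by (intro mult_left_mono) auto
      \<comment> \<open>On the level set \<open>u\<close> is exchanged for \<open>g x\<close>,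
        because \<open>V\<close> is controlled under the density \<open>g\<close> and not under the
        uniform measure.\<close>
      moreover have "u * \<bar>V x\<bar> \<le> g x * \<bar>V x\<bar>"
        using True by (intro mult_right_mono) auto
      ultimately show ?thesis
        using True by (simp add: \<theta>_def algebra_simps)
    qed (use g_nonneg[OF x] in \<open>simp add: \<theta>_def\<close>)
  qed
  also have "\<dots> = u * (\<Sum>x\<in>cube n. \<theta> x * S x) + (\<Sum>x\<in>cube n. g x * \<bar>V x\<bar>)"
    by (simp add: sum.distrib sum_distrib_left)
  also have "\<dots> \<le> sqrt (8 * L * e) * 2 ^ n / e + sqrt (2 * L) * 2 ^ n"
    using upper V_le e by (intro add_mono) (auto simp: field_simps)
  finally have "L * X \<le> sqrt (8 * L * e) / e + sqrt (2 * L)"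
    by (simp add: X_def field_simps)
  \<comment> \<open>The final constant is \<open>5 = 3 + 2\<close>, from
    \<open>sqrt 8 \<le> 3\<close>, \<open>sqrt 2 \<le> 2\<close> and
    \<open>e \<le> 1\<close>.\<close>
  also have "sqrt (8 * L * e) / e \<le> 3 * sqrt L / sqrt e"
  proof -
    have s8: "sqrt 8 \<le> (3::real)"
      by (rule real_le_lsqrt) auto
    have "sqrt (8 * L * e) / e = sqrt 8 * (sqrt L * (sqrt e / e))"
      by (simp add: real_sqrt_mult)
    also have "sqrt e / e = 1 / sqrt e"
      by (simp add: sqrt_divide_self_eq less_imp_le[OF e(1)] inverse_eq_divide)
    also have "sqrt 8 * (sqrt L * (1 / sqrt e)) \<le> 3 * (sqrt L * (1 / sqrt e))"
      by (rule mult_right_mono[OF s8]) (use L e in simp)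
    finally show ?thesis by simp
  qed
  also have "sqrt (2 * L) \<le> 2 * sqrt L / sqrt e"
  proof -
    have "sqrt (2 * L) \<le> sqrt (4 * L)" using L by simp
    also have "\<dots> = 2 * sqrt L" by (simp add: real_sqrt_mult)
    also have "\<dots> \<le> 2 * sqrt L / sqrt e"
      using e L by (simp add: field_simps)
    finally show ?thesis .
  qed
  finally have "L * X \<le> sqrt L * 5 / sqrt e"
    by (simp add: mult.commute)
  \<comment> \<open>Cancelling one of the two factors \<open>sqrt L\<close> leaves the gain
    \<open>1 / sqrt L\<close>.\<close>
  then have "sqrt L * (sqrt L * X) \<le> sqrt L * (5 / sqrt e)"
    using L by (simp flip: mult.assoc)
  then have "sqrt L * X \<le> 5 / sqrt e"
    using L by (simp only: mult_le_cancel_left_pos real_sqrt_gt_0_iff)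
  then have "X \<le> 5 / sqrt (e * L)"
    using L e by (simp add: real_sqrt_mult field_simps)
  moreover have "(\<Sum>x\<in>cube n. \<theta> x) = real (card {x \<in> cube n. u \<le> g x})"
    by (simp add: \<theta>_def finite_cube Int_def)
  ultimately show ?thesis
    by (simp add: X_def e_def L_def g_def)
qed

section \<open>The convolution operator as the noise operator\<close>

text \<open>The expression \<open>(1 + a * s) / 2\<close> gives the mass of both signs
  \<open>s\<close>, and on a finite space the singletons determine the measure.\<close>

lemma mu_eq_point_measure:
  assumes a: "0 < a" "a < 1"
  shows "mu n a = point_measure (cube n) (\<lambda>z. ennreal (\<Prod>k<n. (1 + a * z k) / 2))"
proof (rule measure_eqI_finite[where A = "cube n"])
  fix z assume z: "z \<in> cube n"
  interpret product_prob_space "\<lambda>_. sign_measure a" "{..<n}"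
    by (rule product_prob_spaceI) (rule prob_space_sign_measure[OF a])
  have "{z} = Pi\<^sub>E {..<n} (\<lambda>k. {z k})"
    using z by (simp add: cube_def PiE_singleton PiE_iff)
  then have "emeasure (mu n a) {z} = (\<Prod>k<n. emeasure (sign_measure a) {z k})"
    unfolding mu_def using cube_coord[OF z]
    by (simp only:) (subst emeasure_PiM, auto simp: sign_measure_def sets_point_measure)
  also have "\<dots> = (\<Prod>k<n. ennreal ((1 + a * z k) / 2))"
  proof (rule prod.cong[OF refl])
    fix k assume "k \<in> {..<n}"
    then show "emeasure (sign_measure a) {z k} = ennreal ((1 + a * z k) / 2)"
      using cube_coord[OF z, of k] unfolding sign_measure_def
      by (subst emeasure_point_measure_finite) auto
  qed
  also have "\<dots> = ennreal (\<Prod>k<n. (1 + a * z k) / 2)"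
  proof (rule prod_ennreal)
    fix k assume "k \<in> {..<n}"
    then show "0 \<le> (1 + a * z k) / 2"
      using cube_coord[OF z, of k] a by auto
  qed
  finally show "emeasure (mu n a) {z} =
      emeasure (point_measure (cube n) (\<lambda>z. ennreal (\<Prod>k<n. (1 + a * z k) / 2))) {z}"
    using z by (simp add: emeasure_point_measure_finite finite_cube)
qed (simp_all add: sets_mu sets_point_measure finite_cube)

text \<open>Multiplication by \<open>x\<close> is an involution of the cube, so substituting
  \<open>y\<close> for the product of \<open>x\<close> and \<open>z\<close> turns \<open>z k\<close>
  into \<open>x k * y k\<close>. The halves collect into \<open>1 / 2 ^ n\<close>.\<close>

lemma conv_op_mu:
  assumes a: "0 < a" "a < 1" and x: "x \<in> cube n"
  shows "conv_op n (mu n a) f x = noise_op n a f x"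
proof -
  have invol: "cube_mult n x (cube_mult n x z) = z" if "z \<in> cube n" for z
  proof
    fix k show "cube_mult n x (cube_mult n x z) k = z k"
      using cube_coord_sq[OF x, of k] that
      by (auto simp: cube_mult_def cube_def PiE_iff extensional_def mult.assoc[symmetric])
  qed
  have closed: "cube_mult n x z \<in> cube n" if "z \<in> cube n" for z
    using cube_coord[OF x] cube_coord[OF that] by (fastforce simp: cube_def cube_mult_def)
  have "conv_op n (mu n a) f x = (\<Sum>z\<in>cube n. (\<Prod>k<n. (1 + a * z k) / 2) * f (cube_mult n x z))"
    unfolding conv_op_def mu_eq_point_measure[OF a]
  proof (subst lebesgue_integral_point_measure_finite)
    fix z assume z: "z \<in> cube n"
    show "0 \<le> (\<Prod>k<n. (1 + a * z k) / 2)"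
    proof (rule prod_nonneg)
      fix k assume "k \<in> {..<n}"
      then show "0 \<le> (1 + a * z k) / 2"
        using cube_coord[OF z, of k] a by auto
    qed
  qed (simp_all add: finite_cube)
  also have "\<dots> = (\<Sum>y\<in>cube n. (\<Prod>k<n. (1 + a * x k * y k) / 2) * f y)"
  proof (rule sum.reindex_bij_witness[of _ "cube_mult n x" "cube_mult n x"])
    fix z assume z: "z \<in> cube n"
    show "(\<Prod>k<n. (1 + a * x k * cube_mult n x z k) / 2) * f (cube_mult n x z) =
        (\<Prod>k<n. (1 + a * z k) / 2) * f (cube_mult n x z)"
    proof (intro arg_cong2[where f = "(*)"] prod.cong refl)
      fix k assume "k \<in> {..<n}"
      then show "(1 + a * x k * cube_mult n x z k) / 2 = (1 + a * z k) / 2"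
        using cube_coord_sq[OF x, of k] by (simp add: cube_mult_def mult.assoc)
    qed
  qed (simp_all add: invol closed)
  also have "\<dots> = noise_op n a f x"
    by (simp add: noise_op_def noise_kernel_def prod_dividef sum_divide_distrib mult.commute)
  finally show ?thesis .
qed

text \<open>For \<open>ln u \<ge> 1\<close> this is \<open>noise_op_tail\<close>. For smaller
  \<open>u\<close>, Markov's inequality bounds each value by 1, and the right-hand side is at least
  5 because \<open>(1 - a\<^sup>2) * ln u \<le> 1\<close>.\<close>

lemma psi_mu_le:
  assumes a: "0 < a" "a < 1" and u: "1 < u"
  shows "psi n (mu n a) u \<le> 5 / sqrt ((1 - a\<^sup>2) * ln u)"
  unfolding psi_def
proof (rule cSup_least[OF psi_set_nonempty])
  fix v assume "v \<in> psi_set n (mu n a) u"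
  then obtain f where f: "f \<in> cube n \<rightarrow> {0..}" and norm: "L1_norm n f = 1"
    and v: "v = u * measure (cube_unif n) {x \<in> cube n. u \<le> conv_op n (mu n a) f x}"
    by (auto simp: psi_set_def)
  let ?A = "{x \<in> cube n. u \<le> noise_op n a f x}"
  have f_nonneg: "0 \<le> f x" if "x \<in> cube n" for x
    using f that by auto
  have "(\<Sum>x\<in>cube n. \<bar>f x\<bar>) = (\<Sum>x\<in>cube n. f x)"
    by (intro sum.cong) (auto simp: f_nonneg)
  then have total: "(\<Sum>x\<in>cube n. f x) = 2 ^ n"
    using norm by (simp add: L1_norm_def cube_unif_def integral_uniform_count_measure finite_cube card_cube)
  have "{x \<in> cube n. u \<le> conv_op n (mu n a) f x} = ?A"
    using conv_op_mu[OF a] by auto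
  then have v_eq: "v = u * real (card ?A) / 2 ^ n"
    unfolding v cube_unif_def
    by (simp only:) (subst measure_uniform_count_measure, auto simp: finite_cube card_cube)
  show "v \<le> 5 / sqrt ((1 - a\<^sup>2) * ln u)"
  proof (cases "1 \<le> ln u")
    case True
    then show ?thesis
      unfolding v_eq using a u f_nonneg total by (intro noise_op_tail) auto
  next
    case False
    have "u * real (card ?A) = (\<Sum>x\<in>?A. u)"
      by simp
    also have "\<dots> \<le> (\<Sum>x\<in>?A. noise_op n a f x)"
      by (intro sum_mono) auto
    also have "\<dots> \<le> (\<Sum>x\<in>cube n. noise_op n a f x)"
      using a f_nonneg by (intro sum_mono2) (auto simp: finite_cube intro: noise_op_nonneg)
    finally have "v \<le> 1"
      by (simp add: v_eq sum_noise_op total)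
    also have "1 \<le> 5 / sqrt ((1 - a\<^sup>2) * ln u)"
    proof -
      have pos: "0 < (1 - a\<^sup>2) * ln u"
        using a u by (simp add: abs_square_less_1)
      have "(1 - a\<^sup>2) * ln u \<le> 1 * 1"
        using False a u by (intro mult_mono) (auto simp: abs_square_less_1)
      with pos show ?thesis
        by (simp add: le_divide_eq real_le_lsqrt order_trans[of _ 1])
    qed
    finally show ?thesis .
  qed
qed

section \<open>Comparison with \<open>kappa\<close> and conclusion\<close>

text \<open>After squaring, \<open>1 / (1 - a\<^sup>2) \<le> ?k\<close> amounts to
  \<open>1 \<le> (1 + a)\<^sup>2\<close>, and \<open>ln ?k \<ge> 1 - 1 / ?k\<close> bounds the
  logarithmic quotient below by \<open>1 / ?k\<close>. It remains that
  \<open>?k \<le> ?k ^ 3\<close>.\<close>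

lemma inverse_sqrt_le_kappa:
  assumes a: "0 < a" "a < 1"
  shows "1 / sqrt (1 - a\<^sup>2) \<le> (kappa a)\<^sup>2 * sqrt (ln (kappa a) / (kappa a - 1))"
proof -
  let ?k = "kappa a"
  have k: "1 < ?k"
    using a by (simp add: kappa_def)
  have "1 - 1 / ?k \<le> ln ?k"
    using ln_le_minus_one[of "1 / ?k"] k by (simp add: ln_div)
  then have ln: "1 / ?k \<le> ln ?k / (?k - 1)"
    using k by (simp add: field_simps)
  have "1 / (1 - a\<^sup>2) \<le> ?k"
  proof -
    have "1 \<le> (1 + a) * (1 + a)"
      using a by (simp add: algebra_simps)
    moreover have "1 - a\<^sup>2 = (1 - a) * (1 + a)"
      by (simp add: power2_eq_square algebra_simps)
    ultimately show ?thesis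
      using a by (simp add: kappa_def divide_simps)
  qed
  also have "?k \<le> ?k ^ 4 * (1 / ?k)"
    using k power_increasing[of 1 3 ?k] by (simp add: power_numeral_reduce)
  also have "\<dots> \<le> ?k ^ 4 * (ln ?k / (?k - 1))"
    using ln k by (intro mult_left_mono) auto
  finally have "sqrt (1 / (1 - a\<^sup>2)) \<le> sqrt (?k ^ 4 * (ln ?k / (?k - 1)))"
    by simp
  moreover have "sqrt (?k ^ 4) = ?k\<^sup>2"
    by (rule real_sqrt_unique) auto
  ultimately show ?thesis
    by (simp add: real_sqrt_mult real_sqrt_divide)
qed

theorem theorem1p1:
  "\<exists>C::real. C > 0 \<and>
     (\<forall>(a::real) (u::real) (n::nat). 0 < a \<and> a < 1 \<and> u > 1 \<and> n \<ge> 1 \<longrightarrow>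
        psi n (mu n a) u
          \<le> C * (kappa a)\<^sup>2 * sqrt (ln (kappa a) / (kappa a - 1)) * (1 / sqrt (ln u)))"
proof (intro exI[of _ 5] conjI allI impI)
  fix a u :: real and n :: nat
  assume "0 < a \<and> a < 1 \<and> u > 1 \<and> n \<ge> 1"
  then have a: "0 < a" "a < 1" and u: "1 < u" by auto
  \<comment> \<open>The dimension-free bound splits into a factor in \<open>a\<close>, which is
    compared with \<open>kappa a\<close>, and the factor in \<open>u\<close>.\<close>
  have "psi n (mu n a) u \<le> 5 * (1 / sqrt (1 - a\<^sup>2)) * (1 / sqrt (ln u))"
    using psi_mu_le[OF a u] by (simp add: real_sqrt_mult)
  also have "\<dots> \<le> 5 * ((kappa a)\<^sup>2 * sqrt (ln (kappa a) / (kappa a - 1))) * (1 / sqrt (ln u))"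
    using inverse_sqrt_le_kappa[OF a] u by (intro mult_right_mono mult_left_mono) auto
  finally show "psi n (mu n a) u
      \<le> 5 * (kappa a)\<^sup>2 * sqrt (ln (kappa a) / (kappa a - 1)) * (1 / sqrt (ln u))"
    by (simp add: mult.assoc)
qed simp

end
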